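(* Assume $f$ is twice differentiable. Then $f$ is convex if and only if its domain $\mathbf{dom} f$ is convex and, for all $x \in \mathbf{dom} f$, $$\nabla^2 f(x) \geq 0.$$
   Context: Here $f$ is a real-valued function of a variable in $\mathbb{R}^n$, with domain $\mathbf{dom} f \subseteq \mathbb{R}^n$. The symbol $\nabla^2 f(x)$ stands for the second derivative of $f$ if the domain of $f$ is in $\mathbb{R}$, or the Hessian matrix of $f$ if the domain of $f$ is in $\mathbb{R}^n$; in the latter case "$\geq 0$" means that the Hessian matrix is positive semidefinite. A set $C$ is convex if $\theta x_1 + (1-\theta) x_2 \in C$ for all $x_1, x_2 \in C$ and all $0 \leq \theta \leq 1$. The function $f$ is convex if $\mathbf{dom} f$ is a convex set and $f(\theta x + (1-\theta) y) \leq \theta f(x) + (1-\theta) f(y)$ for all $x, y \in \mathbf{dom} f$ and all $\theta$ with $0 \leq \theta \leq 1$. *)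

theory Defs
  imports "HOL-Analysis.Analysis"
begin

text \<open>
  A function with domain \<open>S\<close> is represented by a total function together with the set \<open>S\<close>.
  Its derivative at a point is meaningful only if it is defined near that point, so the domain of
  a twice differentiable function is open; none of the notions below then depends on the
  values outside \<open>S\<close>.
\<close>

definition twice_differentiable_on :: "('a::real_normed_vector \<Rightarrow> real) \<Rightarrow> 'a set \<Rightarrow> bool" where
  "twice_differentiable_on f S \<longleftrightarrow>
     open S \<and>
     (\<exists>(f' :: 'a \<Rightarrow> 'a \<Rightarrow>\<^sub>L real) f''. \<forall>x\<in>S.
        (f has_derivative blinfun_apply (f' x)) (at x) \<and> (f' has_derivative f'' x) (at x))"

definition partial_deriv :: "'n::finite \<Rightarrow> (real^'n \<Rightarrow> real) \<Rightarrow> real^'n \<Rightarrow> real" where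
  "partial_deriv i f x = deriv (\<lambda>t. f (x + t *\<^sub>R axis i 1)) 0"

definition hessian :: "(real^'n::finite \<Rightarrow> real) \<Rightarrow> real^'n \<Rightarrow> real^'n^'n" where
  "hessian f x = (\<chi> i j. partial_deriv i (partial_deriv j f) x)"

definition positive_semidefinite :: "real^'n::finite^'n \<Rightarrow> bool" where
  "positive_semidefinite A \<longleftrightarrow> transpose A = A \<and> (\<forall>v. 0 \<le> v \<bullet> (A *v v))"

end

theory Submission
  imports Defs
begin

text \<open>
  Both equivalences are instances of one coordinate-free statement. Let \<open>f'\<close> and \<open>f''\<close> be the first
  and second Frechet derivatives of \<open>f\<close> on an open set \<open>S\<close> of a normed space. Convexity can be
  tested on lines, and along a line \<open>t \<mapsto> x + t v\<close> the function \<open>f\<close> restricts to a function of one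
  real variable whose derivatives are \<open>f'(x + t v) v\<close> and \<open>f''(x + t v) v v\<close>. If the latter is never
  negative, the restriction is convex by the classical one-variable criterion. Conversely, a convex
  function lies above its tangents; comparing the tangents at two points of a line shows that its
  slope is nondecreasing, so the derivative of the slope is nonnegative. Hence, over a convex
  domain, \<open>f\<close> is convex iff \<open>f'' v v \<ge> 0\<close> everywhere (lemma
  \<open>convex_on_iff_second_derivative_nonneg\<close>).

  In one variable \<open>f''(x) v v\<close> is \<open>v\<^sup>2\<close> times the second derivative. In several variables the entries
  of the Hessian are the values of \<open>f''(x)\<close> on pairs of basis vectors, so \<open>f''(x) v v\<close> is the
  quadratic form of the Hessian. Positive semidefiniteness also demands that the Hessian be
  symmetric. No continuity of \<open>f''\<close> is assumed, so symmetry is obtained from differentiability of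
  \<open>f'\<close> at the single point \<open>x\<close>: the second-order difference quotient
  \<open>(f(x + t u + t v) - f(x + t u) - f(x + t v) + f(x)) / t\<^sup>2\<close>, which is symmetric in \<open>u\<close> and \<open>v\<close>,
  tends to \<open>f''(x) v u\<close> (lemma \<open>second_difference_quotient_tendsto\<close>).
\<close>

section \<open>Derivatives along a line\<close>

lemma has_real_derivative_along_line:
  fixes f :: "'a::real_normed_vector \<Rightarrow> real"
  assumes "(f has_derivative f') (at (x + t *\<^sub>R v))"
  shows "((\<lambda>s. f (x + s *\<^sub>R v)) has_real_derivative f' v) (at t)"
proof -
  have "((\<lambda>s. x + s *\<^sub>R v) has_derivative (\<lambda>s. s *\<^sub>R v)) (at t)"
    by (auto intro!: derivative_eq_intros)
  from has_derivative_compose[OF this assms]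
  have "((\<lambda>s. f (x + s *\<^sub>R v)) has_derivative (\<lambda>s. f' (s *\<^sub>R v))) (at t)" .
  moreover have "f' (s *\<^sub>R v) = f' v * s" for s
    using linear_scale[OF has_derivative_linear[OF assms], of s v] by simp
  ultimately show ?thesis
    by (simp add: has_field_derivative_def)
qed

lemma has_derivative_blinfun_apply_const:
  fixes f' :: "'a::real_normed_vector \<Rightarrow> 'a \<Rightarrow>\<^sub>L real"
  assumes "(f' has_derivative f'') (at x)"
  shows "((\<lambda>y. f' y v) has_derivative (\<lambda>h. f'' h v)) (at x)"
  by (rule bounded_linear.has_derivative[OF blinfun.bounded_linear_left assms])

section \<open>Symmetry of the second derivative\<close>

text \<open>
  The mean value theorem, applied to \<open>s \<mapsto> f (x + s u + t v) - f (x + s u)\<close> on \<open>[0, t]\<close>, turns the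
  second difference into \<open>t\<close> times a difference of two values of \<open>f'\<close> at points within \<open>O(t)\<close> of
  \<open>x\<close>. Expanding both values about \<open>x\<close> to first order, the unknown intermediate point cancels
  because \<open>f''\<close> is linear.
\<close>

lemma second_difference_quotient_tendsto:
  fixes f :: "'a::real_normed_vector \<Rightarrow> real" and f' :: "'a \<Rightarrow> 'a \<Rightarrow>\<^sub>L real"
  assumes S: "open S" "x \<in> S"
    and f': "\<And>y. y \<in> S \<Longrightarrow> (f has_derivative f' y) (at y)"
    and f'': "(f' has_derivative f'') (at x)"
  shows "((\<lambda>t. (f (x + t *\<^sub>R u + t *\<^sub>R v) - f (x + t *\<^sub>R u) - f (x + t *\<^sub>R v) + f x) / t\<^sup>2)
           \<longlongrightarrow> f'' v u) (at_right 0)"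
proof (rule tendstoI)
  fix e :: real assume "e > 0"
  \<comment> \<open>The two remainders of \<open>f'\<close> sum to at most \<open>e' t (2 \<parallel>u\<parallel> + \<parallel>v\<parallel>)\<close>, and evaluation at \<open>u\<close>
    contributes another factor \<open>\<parallel>u\<parallel>\<close>; the summand 1 keeps \<open>c\<close> positive when \<open>u = 0\<close>.\<close>
  define c where "c = (2 * norm u + norm v) * norm u + 1"
  have "c > 0" unfolding c_def by (smt (verit) norm_ge_zero mult_nonneg_nonneg)
  define e' where "e' = e / (2 * c)"
  have "e' > 0" using \<open>e > 0\<close> \<open>c > 0\<close> by (simp add: e'_def)
  obtain d1 where d1: "d1 > 0" "\<And>y. norm (y - x) < d1 \<Longrightarrow> y \<in> S"
    using S unfolding open_dist by (auto simp: dist_norm)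
  obtain d2 where d2: "d2 > 0"
    "\<And>y. norm (y - x) < d2 \<Longrightarrow> norm (f' y - f' x - f'' (y - x)) \<le> e' * norm (y - x)"
    using f'' \<open>e' > 0\<close> unfolding has_derivative_at_alt by blast
  define d where "d = min d1 d2 / (norm u + norm v + 1)"
  have pos: "norm u + norm v + 1 > 0" by (smt (verit) norm_ge_zero)
  have "d > 0" using d1 d2 pos by (simp add: d_def)
  have lin: "linear f''" using f'' by (rule has_derivative_linear)
  have "dist ((f (x + t *\<^sub>R u + t *\<^sub>R v) - f (x + t *\<^sub>R u) - f (x + t *\<^sub>R v) + f x) / t\<^sup>2)
             (f'' v u) < e" if t: "0 < t" "t < d" for t
  proof -
    have small: "norm (s *\<^sub>R u + r *\<^sub>R v) < min d1 d2"
      if "0 \<le> s" "s \<le> t" "0 \<le> r" "r \<le> t" for s r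
    proof -
      have "norm (s *\<^sub>R u + r *\<^sub>R v) \<le> s * norm u + r * norm v"
        using norm_triangle_ineq[of "s *\<^sub>R u" "r *\<^sub>R v"] that by simp
      also have "\<dots> \<le> t * norm u + t * norm v"
        using that by (intro add_mono mult_right_mono) auto
      also have "\<dots> < t * (norm u + norm v + 1)"
        using t by (simp add: algebra_simps)
      also have "\<dots> < d * (norm u + norm v + 1)"
        using t pos by simp
      also have "\<dots> = min d1 d2" using pos by (simp add: d_def)
      finally show ?thesis .
    qed
    have inS: "x + s *\<^sub>R u + r *\<^sub>R v \<in> S" if "0 \<le> s" "s \<le> t" "0 \<le> r" "r \<le> t" for s r
      using small[OF that] by (intro d1(2)) (simp add: add.assoc)
    define \<phi> where "\<phi> = (\<lambda>s. f (x + t *\<^sub>R v + s *\<^sub>R u) - f (x + s *\<^sub>R u))"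
    have "(\<phi> has_real_derivative
        (f' (x + t *\<^sub>R v + s *\<^sub>R u) u - f' (x + s *\<^sub>R u) u)) (at s)"
      if "0 \<le> s" "s \<le> t" for s
      unfolding \<phi>_def using inS[OF that, of t] inS[OF that, of 0] t
      by (intro DERIV_diff has_real_derivative_along_line f') (simp_all add: algebra_simps)
    from MVT2[OF t(1) this] obtain \<xi> where \<xi>: "0 < \<xi>" "\<xi> < t"
      "\<phi> t - \<phi> 0 = t * (f' (x + t *\<^sub>R v + \<xi> *\<^sub>R u) u - f' (x + \<xi> *\<^sub>R u) u)"
      by auto
    \<comment> \<open>The remainder of the first-order expansion of \<open>f'\<close> about \<open>x\<close>.\<close>
    define R where "R h = f' (x + h) - f' x - f'' h" for h
    have R: "norm (R (\<xi> *\<^sub>R u + r *\<^sub>R v)) \<le> e' * (t * norm u + r * norm v)"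
      if "0 \<le> r" "r \<le> t" for r
    proof -
      have "norm (R (\<xi> *\<^sub>R u + r *\<^sub>R v)) \<le> e' * norm (\<xi> *\<^sub>R u + r *\<^sub>R v)"
        using d2(2)[of "x + (\<xi> *\<^sub>R u + r *\<^sub>R v)"] small[of \<xi> r] that \<xi> by (simp add: R_def)
      also have "\<dots> \<le> e' * (t * norm u + r * norm v)"
      proof (rule mult_left_mono)
        have "norm (\<xi> *\<^sub>R u + r *\<^sub>R v) \<le> \<xi> * norm u + r * norm v"
          using norm_triangle_ineq[of "\<xi> *\<^sub>R u" "r *\<^sub>R v"] that \<xi> by simp
        also have "\<dots> \<le> t * norm u + r * norm v"
          using \<xi> by (simp add: mult_right_mono)
        finally show "norm (\<xi> *\<^sub>R u + r *\<^sub>R v) \<le> t * norm u + r * norm v" .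
      qed (use \<open>e' > 0\<close> in simp)
      finally show ?thesis .
    qed
    have "f' (x + t *\<^sub>R v + \<xi> *\<^sub>R u) - f' (x + \<xi> *\<^sub>R u) - t *\<^sub>R f'' v
        = R (\<xi> *\<^sub>R u + t *\<^sub>R v) - R (\<xi> *\<^sub>R u + 0 *\<^sub>R v)"
      by (simp add: R_def linear_add[OF lin] linear_scale[OF lin] algebra_simps)
    also have "norm \<dots> \<le> e' * (t * norm u + t * norm v) + e' * (t * norm u + 0 * norm v)"
      using R[of t] R[of 0] t norm_triangle_ineq4 by (smt (verit))
    finally have diff: "norm (f' (x + t *\<^sub>R v + \<xi> *\<^sub>R u) - f' (x + \<xi> *\<^sub>R u) - t *\<^sub>R f'' v)
        \<le> e' * t * (2 * norm u + norm v)"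
      by (simp add: algebra_simps)
    have "\<bar>\<phi> t - \<phi> 0 - t\<^sup>2 * f'' v u\<bar>
        = t * norm ((f' (x + t *\<^sub>R v + \<xi> *\<^sub>R u) - f' (x + \<xi> *\<^sub>R u) - t *\<^sub>R f'' v) u)"
    proof -
      have "\<phi> t - \<phi> 0 - t\<^sup>2 * f'' v u
          = t * (f' (x + t *\<^sub>R v + \<xi> *\<^sub>R u) - f' (x + \<xi> *\<^sub>R u) - t *\<^sub>R f'' v) u"
        unfolding \<xi>(3) by (simp add: blinfun.bilinear_simps algebra_simps power2_eq_square)
      then show ?thesis using t by (simp add: abs_mult)
    qed
    also have "\<dots> \<le> t * (e' * t * (2 * norm u + norm v) * norm u)"
      using t by (intro mult_left_mono
          order_trans[OF norm_blinfun mult_right_mono[OF diff norm_ge_zero]]) simp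
    also have "\<dots> = t\<^sup>2 * (e' * (c - 1))"
      by (simp add: c_def power2_eq_square algebra_simps)
    also have "\<dots> < t\<^sup>2 * e"
    proof -
      have "e' * (c - 1) < e' * (2 * c)" using \<open>e' > 0\<close> \<open>c > 0\<close> by (intro mult_strict_left_mono) auto
      also have "\<dots> = e" using \<open>c > 0\<close> by (simp add: e'_def)
      finally show ?thesis using t by simp
    qed
    finally have "\<bar>\<phi> t - \<phi> 0 - t\<^sup>2 * f'' v u\<bar> < t\<^sup>2 * e" .
    moreover have "(\<phi> t - \<phi> 0) / t\<^sup>2 - f'' v u = (\<phi> t - \<phi> 0 - t\<^sup>2 * f'' v u) / t\<^sup>2"
      using t by (simp add: field_simps)
    ultimately have "\<bar>(\<phi> t - \<phi> 0) / t\<^sup>2 - f'' v u\<bar> < e"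
      using t by (simp add: abs_divide pos_divide_less_eq mult.commute)
    moreover have "f (x + t *\<^sub>R u + t *\<^sub>R v) - f (x + t *\<^sub>R u) - f (x + t *\<^sub>R v) + f x = \<phi> t - \<phi> 0"
      by (simp add: \<phi>_def algebra_simps)
    ultimately show ?thesis by (simp add: dist_real_def)
  qed
  then show "\<forall>\<^sub>F t in at_right 0.
      dist ((f (x + t *\<^sub>R u + t *\<^sub>R v) - f (x + t *\<^sub>R u) - f (x + t *\<^sub>R v) + f x) / t\<^sup>2) (f'' v u) < e"
    unfolding eventually_at_right_field using \<open>d > 0\<close> by blast
qed

lemma second_derivative_symmetric:
  fixes f :: "'a::real_normed_vector \<Rightarrow> real" and f' :: "'a \<Rightarrow> 'a \<Rightarrow>\<^sub>L real"
  assumes "open S" "x \<in> S"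
    and "\<And>y. y \<in> S \<Longrightarrow> (f has_derivative f' y) (at y)"
    and "(f' has_derivative f'') (at x)"
  shows "f'' u v = f'' v u"
proof -
  have "((\<lambda>t. (f (x + t *\<^sub>R u + t *\<^sub>R v) - f (x + t *\<^sub>R u) - f (x + t *\<^sub>R v) + f x) / t\<^sup>2)
           \<longlongrightarrow> f'' u v) (at_right 0)"
    using second_difference_quotient_tendsto[OF assms, of v u] by (simp add: algebra_simps)
  from tendsto_unique[OF _ this second_difference_quotient_tendsto[OF assms]]
  show ?thesis by simp
qed

section \<open>Convexity and the second derivative\<close>

lemma convex_line_preimage:
  assumes "convex S"
  shows "convex {t. x + t *\<^sub>R v \<in> S}"
  unfolding convex_alt
proof safe
  fix s t \<mu> :: real
  assume "x + s *\<^sub>R v \<in> S" "x + t *\<^sub>R v \<in> S" "0 \<le> \<mu>" "\<mu> \<le> 1"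
  then have "(1 - \<mu>) *\<^sub>R (x + s *\<^sub>R v) + \<mu> *\<^sub>R (x + t *\<^sub>R v) \<in> S"
    using assms unfolding convex_alt by blast
  then show "x + ((1 - \<mu>) *\<^sub>R s + \<mu> *\<^sub>R t) *\<^sub>R v \<in> S"
    by (simp add: algebra_simps)
qed

lemma open_line_preimage:
  fixes x v :: "'a::real_normed_vector"
  assumes "open S"
  shows "open {t. x + t *\<^sub>R v \<in> S}"
  using open_vimage[OF assms, of "\<lambda>t. x + t *\<^sub>R v"]
  by (simp add: vimage_def continuous_intros)

lemma convex_on_iff_convex_on_lines:
  "convex_on S f \<longleftrightarrow>
    convex S \<and> (\<forall>x v. convex_on {t. x + t *\<^sub>R v \<in> S} (\<lambda>t. f (x + t *\<^sub>R v)))"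
proof safe
  fix x v assume f: "convex_on S f"
  then have "convex S" by (rule convex_on_imp_convex)
  show "convex_on {t. x + t *\<^sub>R v \<in> S} (\<lambda>t. f (x + t *\<^sub>R v))"
  proof
    fix \<mu> s t :: real
    assume "0 < \<mu>" "\<mu> < 1" "s \<in> {t. x + t *\<^sub>R v \<in> S}" "t \<in> {t. x + t *\<^sub>R v \<in> S}"
    then have "f ((1 - \<mu>) *\<^sub>R (x + s *\<^sub>R v) + \<mu> *\<^sub>R (x + t *\<^sub>R v))
        \<le> (1 - \<mu>) * f (x + s *\<^sub>R v) + \<mu> * f (x + t *\<^sub>R v)"
      by (intro convex_onD[OF f]) auto
    then show "f (x + ((1 - \<mu>) *\<^sub>R s + \<mu> *\<^sub>R t) *\<^sub>R v)
        \<le> (1 - \<mu>) * f (x + s *\<^sub>R v) + \<mu> * f (x + t *\<^sub>R v)"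
      by (simp add: algebra_simps)
  qed (rule convex_line_preimage[OF \<open>convex S\<close>])
next
  assume "convex S"
    and lines: "\<forall>x v. convex_on {t. x + t *\<^sub>R v \<in> S} (\<lambda>t. f (x + t *\<^sub>R v))"
  show "convex_on S f"
  proof
    fix \<mu> :: real and x y
    assume "0 < \<mu>" "\<mu> < 1" "x \<in> S" "y \<in> S"
    then show "f ((1 - \<mu>) *\<^sub>R x + \<mu> *\<^sub>R y) \<le> (1 - \<mu>) * f x + \<mu> * f y"
      using convex_onD[OF lines[rule_format, of x "y - x"], of \<mu> 0 1]
      by (simp add: algebra_simps)
  qed fact
qed (rule convex_on_imp_convex)

text \<open>
  The tangents at \<open>c\<close> and at \<open>t\<close> both lie below \<open>\<phi>\<close>; adding the two inequalities gives
  \<open>(\<phi>' t - \<phi>' c) * (t - c) \<ge> 0\<close>, so the difference quotients of \<open>\<phi>'\<close> at \<open>c\<close> are nonnegative.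
\<close>

lemma convex_on_imp_second_derivative_nonneg:
  fixes \<phi> \<phi>' :: "real \<Rightarrow> real"
  assumes conv: "convex_on T \<phi>" and T: "open T" "c \<in> T"
    and \<phi>': "\<And>t. t \<in> T \<Longrightarrow> (\<phi> has_real_derivative \<phi>' t) (at t)"
    and \<phi>'': "(\<phi>' has_real_derivative \<phi>'') (at c)"
  shows "\<phi>'' \<ge> 0"
proof -
  have above: "\<phi> t - \<phi> s \<ge> \<phi>' s * (t - s)" if "s \<in> T" "t \<in> T" for s t
    using that T conv
    by (intro convex_on_imp_above_tangent[OF conv] has_field_derivative_at_within[OF \<phi>']
        convex_connected) (auto simp: interior_open convex_on_imp_convex)
  have "(\<phi>' t - \<phi>' c) / (t - c) \<ge> 0" if "t \<in> T" for t
  proof -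
    have "(\<phi>' t - \<phi>' c) * (t - c) \<ge> 0"
      using above[OF T(2) that] above[OF that T(2)] by (simp add: algebra_simps)
    then show ?thesis by (simp add: zero_le_mult_iff zero_le_divide_iff)
  qed
  moreover have "\<forall>\<^sub>F t in at c. t \<in> T"
    using T by (intro eventually_at_in_open')
  ultimately have "\<forall>\<^sub>F t in at c. (\<phi>' t - \<phi>' c) / (t - c) \<ge> 0"
    by (auto elim: eventually_mono)
  then show ?thesis
    using \<phi>'' by (intro tendsto_lowerbound[of _ _ "at c"]) (auto simp: has_field_derivative_iff)
qed

text \<open>
  Along the line \<open>t \<mapsto> x + t v\<close> the second derivative is \<open>f'' (x + t v) v v\<close>, so the diagonal values
  of \<open>f''\<close> are exactly what the one-variable criteria on all lines can see.
\<close>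

lemma convex_on_iff_second_derivative_nonneg:
  fixes f :: "'a::real_normed_vector \<Rightarrow> real" and f' :: "'a \<Rightarrow> 'a \<Rightarrow>\<^sub>L real"
  assumes S: "open S"
    and f': "\<And>x. x \<in> S \<Longrightarrow> (f has_derivative f' x) (at x)"
    and f'': "\<And>x. x \<in> S \<Longrightarrow> (f' has_derivative f'' x) (at x)"
  shows "convex_on S f \<longleftrightarrow> convex S \<and> (\<forall>x\<in>S. \<forall>v. 0 \<le> f'' x v v)"
proof -
  have d1: "((\<lambda>s. f (x + s *\<^sub>R v)) has_real_derivative f' (x + t *\<^sub>R v) v) (at t)"
    if "t \<in> {t. x + t *\<^sub>R v \<in> S}" for x v t
    using that by (intro has_real_derivative_along_line f') auto
  have d2: "((\<lambda>s. f' (x + s *\<^sub>R v) v) has_real_derivative f'' (x + t *\<^sub>R v) v v) (at t)"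
    if "t \<in> {t. x + t *\<^sub>R v \<in> S}" for x v t
    using that
    by (intro has_real_derivative_along_line[of "\<lambda>y. f' y v"]
        has_derivative_blinfun_apply_const f'') auto
  show ?thesis
  proof safe
    fix x v assume "convex_on S f" "x \<in> S"
    then have "convex_on {t. x + t *\<^sub>R v \<in> S} (\<lambda>t. f (x + t *\<^sub>R v))"
      using convex_on_iff_convex_on_lines by blast
    from convex_on_imp_second_derivative_nonneg[OF this open_line_preimage[OF S] _ d1 d2, of 0]
    show "0 \<le> f'' x v v" using \<open>x \<in> S\<close> by simp
  next
    assume "convex S" and nonneg: "\<forall>x\<in>S. \<forall>v. 0 \<le> f'' x v v"
    have "convex_on {t. x + t *\<^sub>R v \<in> S} (\<lambda>t. f (x + t *\<^sub>R v))" for x v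
      using nonneg
      by (intro f''_ge0_imp_convex[OF convex_line_preimage[OF \<open>convex S\<close>] d1 d2]) auto
    with \<open>convex S\<close> show "convex_on S f"
      using convex_on_iff_convex_on_lines by blast
  qed (rule convex_on_imp_convex)
qed

section \<open>Coordinates\<close>

lemma partial_deriv_eq:
  assumes "(f has_derivative f') (at x)"
  shows "partial_deriv i f x = f' (axis i 1)"
  unfolding partial_deriv_def
  using assms by (intro DERIV_imp_deriv has_real_derivative_along_line) simp

lemma hessian_component:
  fixes f :: "real^'n::finite \<Rightarrow> real" and f' :: "(real^'n) \<Rightarrow> (real^'n) \<Rightarrow>\<^sub>L real"
  assumes "open S" "x \<in> S"
    and f': "\<And>y. y \<in> S \<Longrightarrow> (f has_derivative f' y) (at y)"
    and f'': "(f' has_derivative f'') (at x)"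
  shows "hessian f x $ i $ j = f'' (axis i 1) (axis j 1)"
proof -
  have "((\<lambda>y. f' y (axis j 1)) has_derivative (\<lambda>h. f'' h (axis j 1))) (at x)"
    using f'' by (rule has_derivative_blinfun_apply_const)
  then have "(partial_deriv j f has_derivative (\<lambda>h. f'' h (axis j 1))) (at x)"
    using assms(1,2)
    by (rule has_derivative_transform_within_open) (simp add: partial_deriv_eq[OF f'])
  then show ?thesis
    by (simp add: hessian_def partial_deriv_eq)
qed

lemma inner_matrix_vector_eq_bilinear:
  fixes B :: "real^'n::finite \<Rightarrow> (real^'n) \<Rightarrow>\<^sub>L real"
  assumes "linear B" and "\<And>i j. A $ i $ j = B (axis i 1) (axis j 1)"
  shows "v \<bullet> (A *v v) = B v v"
proof -
  have "v = (\<Sum>i\<in>UNIV. v $ i *\<^sub>R axis i 1)"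
    using basis_expansion[of v] by (simp add: scalar_mult_eq_scaleR)
  then have "B v v = B (\<Sum>i\<in>UNIV. v $ i *\<^sub>R axis i 1) (\<Sum>j\<in>UNIV. v $ j *\<^sub>R axis j 1)"
    by simp
  also have "\<dots> = (\<Sum>i\<in>UNIV. \<Sum>j\<in>UNIV. v $ i * (v $ j * A $ i $ j))"
    by (simp add: linear_sum[OF assms(1)] linear_scale[OF assms(1)] blinfun.bilinear_simps
        blinfun.sum_left blinfun.sum_right assms(2) sum_distrib_left)
      (subst sum.swap, simp add: mult.left_commute)
  also have "\<dots> = v \<bullet> (A *v v)"
    by (simp add: inner_vec_def matrix_vector_mult_def sum_distrib_left mult.commute)
  finally show ?thesis by simp
qed

lemma positive_semidefinite_hessian_iff:
  fixes f :: "real^'n::finite \<Rightarrow> real" and f' :: "(real^'n) \<Rightarrow> (real^'n) \<Rightarrow>\<^sub>L real"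
  assumes "open S" "x \<in> S"
    and "\<And>y. y \<in> S \<Longrightarrow> (f has_derivative f' y) (at y)"
    and f'': "(f' has_derivative f'') (at x)"
  shows "positive_semidefinite (hessian f x) \<longleftrightarrow> (\<forall>v. 0 \<le> f'' v v)"
proof -
  have "transpose (hessian f x) = hessian f x"
    using second_derivative_symmetric[OF assms]
    by (simp add: vec_eq_iff transpose_def hessian_component[OF assms])
  moreover have "v \<bullet> (hessian f x *v v) = f'' v v" for v
    using has_derivative_linear[OF f''] hessian_component[OF assms]
    by (rule inner_matrix_vector_eq_bilinear)
  ultimately show ?thesis
    by (simp add: positive_semidefinite_def)
qed

lemma deriv_deriv_nonneg_iff:
  fixes g :: "real \<Rightarrow> real" and g' :: "real \<Rightarrow> real \<Rightarrow>\<^sub>L real"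
  assumes "open S" "x \<in> S"
    and g': "\<And>y. y \<in> S \<Longrightarrow> (g has_derivative g' y) (at y)"
    and g'': "(g' has_derivative g'') (at x)"
  shows "deriv (deriv g) x \<ge> 0 \<longleftrightarrow> (\<forall>v. 0 \<le> g'' v v)"
proof -
  have *: "deriv h y = h' 1" if "(h has_derivative h') (at y)" for h h' :: "real \<Rightarrow> real" and y
    using has_real_derivative_along_line[of h h' 0 y 1] that by (simp add: DERIV_imp_deriv)
  have "((\<lambda>y. g' y 1) has_derivative (\<lambda>h. g'' h 1)) (at x)"
    using g'' by (rule has_derivative_blinfun_apply_const)
  then have "(deriv g has_derivative (\<lambda>h. g'' h 1)) (at x)"
    using assms(1,2) by (rule has_derivative_transform_within_open) (simp add: *[OF g'])
  then have "deriv (deriv g) x = g'' 1 1" by (rule *)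
  moreover have "g'' v v = v\<^sup>2 * g'' 1 1" for v
    using linear_scale[OF has_derivative_linear[OF g''], of v 1] blinfun.scaleR_right[of "g'' 1" v 1]
    by (simp add: blinfun.scaleR_left power2_eq_square)
  ultimately show ?thesis
    by (metis mult_nonneg_nonneg zero_le_power2)
qed

theorem theorem7:
  fixes f :: "real^'n::finite \<Rightarrow> real" and D :: "(real^'n) set"
    and g :: "real \<Rightarrow> real" and E :: "real set"
  shows "(twice_differentiable_on f D \<longrightarrow>
            (convex_on D f \<longleftrightarrow> convex D \<and> (\<forall>x\<in>D. positive_semidefinite (hessian f x)))) \<and>
         (twice_differentiable_on g E \<longrightarrow>
            (convex_on E g \<longleftrightarrow> convex E \<and> (\<forall>x\<in>E. deriv (deriv g) x \<ge> 0)))"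
proof (intro conjI impI)
  assume "twice_differentiable_on f D"
  then obtain f' :: "(real^'n) \<Rightarrow> (real^'n) \<Rightarrow>\<^sub>L real" and f'' where "open D"
    and f': "\<And>x. x \<in> D \<Longrightarrow> (f has_derivative f' x) (at x)"
    and f'': "\<And>x. x \<in> D \<Longrightarrow> (f' has_derivative f'' x) (at x)"
    unfolding twice_differentiable_on_def by blast
  show "convex_on D f \<longleftrightarrow> convex D \<and> (\<forall>x\<in>D. positive_semidefinite (hessian f x))"
    using convex_on_iff_second_derivative_nonneg[OF \<open>open D\<close> f' f'']
      positive_semidefinite_hessian_iff[OF \<open>open D\<close> _ f' f''] by simp
next
  assume "twice_differentiable_on g E"
  then obtain g' :: "real \<Rightarrow> real \<Rightarrow>\<^sub>L real" and g'' where "open E"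
    and g': "\<And>x. x \<in> E \<Longrightarrow> (g has_derivative g' x) (at x)"
    and g'': "\<And>x. x \<in> E \<Longrightarrow> (g' has_derivative g'' x) (at x)"
    unfolding twice_differentiable_on_def by blast
  show "convex_on E g \<longleftrightarrow> convex E \<and> (\<forall>x\<in>E. deriv (deriv g) x \<ge> 0)"
    using convex_on_iff_second_derivative_nonneg[OF \<open>open E\<close> g' g'']
      deriv_deriv_nonneg_iff[OF \<open>open E\<close> _ g' g''] by simp
qed

end
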